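(* For all $k\ge 2$, the graphs $K_k$ and $K_{1,k-1}$ and their complements (as elements of $\mathcal{C}(k)$) are unavoidable. Also, the graphs $K_{2,3}\in\mathcal{C}(5)$, $K_{3,4}\in\mathcal{C}(7)$ and $K_4^{-}\in\mathcal{C}(4)$ and their complements are unavoidable.
   Context: Let $k\ge 2$. A red-blue edge coloring of $K_k$ is identified with the graph on $k$ vertices formed by its blue edges (the red edges being the non-edges); $\mathcal{C}(k)$ is the set of all red-blue edge colorings of $K_k$, equivalently of all graphs on $k$ vertices, considered up to isomorphism. For $X\subseteq\mathcal{C}(k)$, an $X$-packing of a red-blue edge coloring of $K_n$ is a set of pairwise edge-disjoint colored copies of $K_k$ in this colored $K_n$, each isomorphic (as a colored graph) to an element of $X$; its size is the number of copies. (Equivalently: for the blue graph $G$ on $n$ vertices, a set of $k$-element vertex subsets, any two sharing at most one vertex, each inducing in $G$ a graph isomorphic to a member of $X$.) $X$ has the asymptotic packing property if for every $\epsilon>0$ and all sufficiently large $n$, every red-blue edge coloring of $K_n$ has an $X$-packing of size at least $\frac{n(n-1)}{k(k-1)}(1-\epsilon)$. A graph $C\in\mathcal{C}(k)$ is avoidable if $\mathcal{C}(k)\setminus\{C\}$ has the asymptotic packing property, and unavoidable otherwise. $K_4^{-}$ is $K_4$ with one edge removed; $K_{a,b}$ is the complete bipartite graph. *)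

theory Defs
  imports Complex_Main "HOL-Library.Ramsey"
begin

text \<open>
  A red-blue edge coloring of the complete graph on a vertex set \<open>V\<close> is given by its set of blue
  edges, a set of two-element subsets of \<open>V\<close>; the edges of \<open>[V]\<^bsup>2\<^esup>\<close> outside this set are red.
\<close>

definition colorings :: "'a set \<Rightarrow> 'a set set set" where
  "colorings V = Pow ([V]\<^bsup>2\<^esup>)"

definition induced :: "'a set set \<Rightarrow> 'a set \<Rightarrow> 'a set set" where
  "induced G S = G \<inter> [S]\<^bsup>2\<^esup>"

definition compl_graph :: "'a set \<Rightarrow> 'a set set \<Rightarrow> 'a set set" where
  "compl_graph V G = [V]\<^bsup>2\<^esup> - G"

definition isomorphic :: "'a set \<Rightarrow> 'a set set \<Rightarrow> 'b set \<Rightarrow> 'b set set \<Rightarrow> bool" where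
  "isomorphic V G W H \<longleftrightarrow>
     (\<exists>f. bij_betw f V W \<and> (\<forall>u\<in>V. \<forall>v\<in>V. {u, v} \<in> G \<longleftrightarrow> {f u, f v} \<in> H))"

definition iso_rel :: "nat \<Rightarrow> (nat set set \<times> nat set set) set" where
  "iso_rel k = {(G, H). G \<in> colorings {..<k} \<and> H \<in> colorings {..<k} \<and>
                        isomorphic {..<k} G {..<k} H}"

text \<open>
  The elements of \<open>\<C>(k)\<close> are the isomorphism classes of graphs on the vertex set \<open>{..<k}\<close>, so that
  removing one element from \<open>\<C>(k)\<close> removes all labelled copies of a graph.
\<close>

definition coloring_classes :: "nat \<Rightarrow> nat set set set set" where
  "coloring_classes k = colorings {..<k} // iso_rel k"

definition iso_class :: "nat \<Rightarrow> nat set set \<Rightarrow> nat set set set" where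
  "iso_class k G = iso_rel k `` {G}"

lemma equiv_iso_rel: "equiv (colorings {..<k}) (iso_rel k)"
proof (rule equivI)
  show "iso_rel k \<subseteq> colorings {..<k} \<times> colorings {..<k}"
    by (auto simp: iso_rel_def)
  have "isomorphic {..<k} G {..<k} G" for G :: "nat set set"
    unfolding isomorphic_def by (rule exI[of _ id]) auto
  then show "refl_on (colorings {..<k}) (iso_rel k)"
    by (auto simp: refl_on_def iso_rel_def)
  have "isomorphic {..<k} H {..<k} G" if "isomorphic {..<k} G {..<k} H"
    for G H :: "nat set set"
  proof -
    from that obtain f where f: "bij_betw f {..<k} {..<k}"
      and e: "\<And>u v. u < k \<Longrightarrow> v < k \<Longrightarrow> {u, v} \<in> G \<longleftrightarrow> {f u, f v} \<in> H"
      unfolding isomorphic_def by blast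
    let ?g = "inv_into {..<k} f"
    have g: "bij_betw ?g {..<k} {..<k}" using f by (rule bij_betw_inv_into)
    have "{u, v} \<in> H \<longleftrightarrow> {?g u, ?g v} \<in> G" if "u < k" "v < k" for u v
    proof -
      have "?g u < k" "?g v < k" using bij_betwE[OF g] that by auto
      moreover have "f (?g u) = u" "f (?g v) = v"
        using f that by (auto intro: bij_betw_inv_into_right)
      ultimately show ?thesis using e by metis
    qed
    with g show ?thesis unfolding isomorphic_def by blast
  qed
  then show "sym (iso_rel k)"
    by (auto simp: sym_def iso_rel_def)
  have "isomorphic {..<k} G {..<k} K"
    if "isomorphic {..<k} G {..<k} H" "isomorphic {..<k} H {..<k} K"
    for G H K :: "nat set set"
  proof -
    from that obtain f g where f: "bij_betw f {..<k} {..<k}" and g: "bij_betw g {..<k} {..<k}"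
      and e: "\<forall>u\<in>{..<k}. \<forall>v\<in>{..<k}. {u, v} \<in> G \<longleftrightarrow> {f u, f v} \<in> H"
             "\<forall>u\<in>{..<k}. \<forall>v\<in>{..<k}. {u, v} \<in> H \<longleftrightarrow> {g u, g v} \<in> K"
      unfolding isomorphic_def by blast
    have "\<forall>u\<in>{..<k}. \<forall>v\<in>{..<k}. {u, v} \<in> G \<longleftrightarrow> {(g \<circ> f) u, (g \<circ> f) v} \<in> K"
      using e bij_betwE[OF f] by simp
    with bij_betw_trans[OF f g] show ?thesis unfolding isomorphic_def by blast
  qed
  then show "trans (iso_rel k)"
    unfolding trans_def iso_rel_def by blast
qed

text \<open>
  A copy of \<open>K\<^sub>k\<close> in the complete graph on \<open>V\<close> is determined by its set \<open>S\<close> of \<open>k\<close> vertices; its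
  edges are \<open>[S]\<^bsup>2\<^esup>\<close>, colored as in the ambient coloring \<open>G\<close>.
\<close>

definition packing ::
  "nat \<Rightarrow> nat set set set set \<Rightarrow> 'a set \<Rightarrow> 'a set set \<Rightarrow> 'a set set \<Rightarrow> bool" where
  "packing k X V G P \<longleftrightarrow>
     P \<subseteq> [V]\<^bsup>k\<^esup> \<and>
     pairwise (\<lambda>S T. disjnt ([S]\<^bsup>2\<^esup>) ([T]\<^bsup>2\<^esup>)) P \<and>
     (\<forall>S\<in>P. \<exists>C\<in>X. \<exists>H\<in>C. isomorphic S (induced G S) {..<k} H)"

definition asymptotic_packing_property :: "nat \<Rightarrow> nat set set set set \<Rightarrow> bool" where
  "asymptotic_packing_property k X \<longleftrightarrow>
     (\<forall>\<epsilon>::real. \<epsilon> > 0 \<longrightarrow>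
       (\<forall>\<^sub>F n in sequentially. \<forall>G\<in>colorings {..<n}. \<exists>P. packing k X {..<n} G P \<and>
          real (card P) \<ge> real n * (real n - 1) / (real k * (real k - 1)) * (1 - \<epsilon>)))"

definition avoidable :: "nat \<Rightarrow> nat set set set \<Rightarrow> bool" where
  "avoidable k C \<longleftrightarrow>
     C \<in> coloring_classes k \<and> asymptotic_packing_property k (coloring_classes k - {C})"

definition unavoidable :: "nat \<Rightarrow> nat set set set \<Rightarrow> bool" where
  "unavoidable k C \<longleftrightarrow> C \<in> coloring_classes k \<and> \<not> avoidable k C"

definition complete_graph :: "nat \<Rightarrow> nat set set" where
  "complete_graph k = [{..<k}]\<^bsup>2\<^esup>"

definition complete_bipartite :: "nat \<Rightarrow> nat \<Rightarrow> nat set set" where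
  "complete_bipartite a b = {{u, v} | u v. u \<in> {..<a} \<and> v \<in> {a..<a + b}}"

definition K4_minus :: "nat set set" where
  "K4_minus = complete_graph 4 - {{0, 1}}"

end

theory Submission
  imports Defs
begin

text \<open>
  The graphs in question are complete multipartite, up to complement. For such a graph \<open>F\<close>, the
  colorings that obstruct packings without \<open>F\<close> are complete multipartite as well: the
  vertices are distributed over parts, and an edge is blue iff it joins different parts. To show that packings without a copy of \<open>F\<close> leave a
  positive fraction of the edges uncovered, put a nonnegative weight on each edge, depending only on
  the parts of its ends, such that every \<open>k\<close>-set not inducing \<open>F\<close> has weight at least some \<open>\<omega>\<close>.
  Edge-disjointness bounds the number of copies in the packing by the total weight divided by \<open>\<omega>\<close>.
  If the average weight of an edge is less than \<open>\<omega>\<close> divided by the number of edges of \<open>K\<^sub>k\<close>,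
  this bound is smaller than the required number by a constant factor. The weights are feasible
  solutions of the dual of the fractional packing problem. This is \<open>unavoidable_by_weights\<close>;
  complementing the coloring gives the same bound for the complement of \<open>F\<close>.

  It remains to choose parts and weights.

  \<^item> \<open>K\<^sub>k\<close>: all parts are singletons, so that every \<open>k\<close>-set induces \<open>K\<^sub>k\<close> and packings without
    \<open>K\<^sub>k\<close> are empty; the weight is zero.
  \<^item> \<open>K\<^bsub>1,k-1\<^esub>\<close>: two parts \<open>A\<close>, \<open>B\<close> in proportion \<open>1 : k - 1\<close>. A permitted copy with a cross edge must
    have at least two vertices in the small part \<open>A\<close>, hence spends an edge inside \<open>A\<close>, and there
    are too few of these to cover all cross edges. The weights are \<open>2k - 3\<close> inside \<open>A\<close>, \<open>1\<close> inside
    \<open>B\<close> and \<open>0\<close> across.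
  \<^item> \<open>K\<^bsub>2,3\<^esub>\<close> and \<open>K\<^bsub>3,4\<^esub>\<close>: two equal parts, so half of the edges are cross edges. The most balanced
    split of a \<open>k\<close>-set is the only one in which more than half of the pairs are cross pairs, and it
    is the forbidden one. The weights are \<open>1\<close> inside a part and \<open>0\<close> across.
  \<^item> \<open>K\<^sub>4\<^sup>-\<close>: three parts \<open>A\<close>, \<open>B\<close>, \<open>C\<close> in proportion \<open>2 : 2 : 1\<close>, where a \<open>4\<close>-set that meets all
    three parts induces the forbidden graph. For three equal parts no weights would do, because
    the split \<open>2 + 2\<close> has the same proportion of cross pairs as the host, two thirds; unequal parts make the
    edges inside \<open>C\<close> scarce. The weights are \<open>4\<close> inside \<open>A\<close> and \<open>B\<close>, \<open>8\<close> inside \<open>C\<close>,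
    \<open>1\<close> between \<open>A\<close> and \<open>B\<close>, and \<open>0\<close> between \<open>C\<close> and the rest.
\<close>

section \<open>Packings that avoid one graph\<close>

text \<open>
  Packing with all classes except that of \<open>F\<close>, expressed without isomorphism classes
  (\<open>packing_imp_avoiding_packing\<close>).
\<close>

definition avoiding_packing ::
  "nat \<Rightarrow> nat set set \<Rightarrow> 'a set \<Rightarrow> 'a set set \<Rightarrow> 'a set set \<Rightarrow> bool" where
  "avoiding_packing k F V G P \<longleftrightarrow>
     P \<subseteq> [V]\<^bsup>k\<^esup> \<and>
     pairwise (\<lambda>S T. disjnt ([S]\<^bsup>2\<^esup>) ([T]\<^bsup>2\<^esup>)) P \<and>
     (\<forall>S\<in>P. \<not> isomorphic S (induced G S) {..<k} F)"

lemma isomorphic_if_common_source: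
  assumes "isomorphic S G V H" "isomorphic S G W K"
  shows "isomorphic V H W K"
proof -
  from assms obtain f g where f: "bij_betw f S V" and g: "bij_betw g S W"
    and fe: "\<And>u v. u \<in> S \<Longrightarrow> v \<in> S \<Longrightarrow> {u, v} \<in> G \<longleftrightarrow> {f u, f v} \<in> H"
    and ge: "\<And>u v. u \<in> S \<Longrightarrow> v \<in> S \<Longrightarrow> {u, v} \<in> G \<longleftrightarrow> {g u, g v} \<in> K"
    unfolding isomorphic_def by blast
  let ?h = "g \<circ> inv_into S f"
  have "bij_betw ?h V W"
    using bij_betw_trans[OF bij_betw_inv_into[OF f] g] .
  moreover have "{u, v} \<in> H \<longleftrightarrow> {?h u, ?h v} \<in> K" if "u \<in> V" "v \<in> V" for u v
  proof -
    have "inv_into S f u \<in> S" "inv_into S f v \<in> S"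
      using bij_betwE[OF bij_betw_inv_into[OF f]] that by auto
    moreover have "f (inv_into S f u) = u" "f (inv_into S f v) = v"
      using f that by (auto intro: bij_betw_inv_into_right)
    ultimately show ?thesis using fe ge by (metis comp_apply)
  qed
  ultimately show ?thesis unfolding isomorphic_def by blast
qed

lemma packing_imp_avoiding_packing:
  assumes F: "F \<in> colorings {..<k}"
    and P: "packing k (coloring_classes k - {iso_class k F}) V G P"
  shows "avoiding_packing k F V G P"
proof -
  have "\<not> isomorphic S (induced G S) {..<k} F" if S: "S \<in> P" for S
  proof
    assume iso: "isomorphic S (induced G S) {..<k} F"
    from P S obtain C H where C: "C \<in> coloring_classes k" "C \<noteq> iso_class k F" and H: "H \<in> C"
      and isoH: "isomorphic S (induced G S) {..<k} H"
      unfolding packing_def by blast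
    from C(1) obtain K where K: "K \<in> colorings {..<k}" "C = iso_rel k `` {K}"
      unfolding coloring_classes_def by (auto elim: quotientE)
    have "(K, H) \<in> iso_rel k" using K(2) H by simp
    moreover have "(H, F) \<in> iso_rel k"
      using isomorphic_if_common_source[OF isoH iso] F \<open>(K, H) \<in> iso_rel k\<close>
      by (simp add: iso_rel_def)
    ultimately have "(K, F) \<in> iso_rel k"
      using equiv_iso_rel[of k] by (meson equiv_def transD)
    hence "C = iso_class k F"
      using equiv_class_eq[OF equiv_iso_rel] K(2) by (simp add: iso_class_def)
    with C(2) show False ..
  qed
  with P show ?thesis unfolding packing_def avoiding_packing_def by blast
qed

text \<open>
  A constant-factor loss along the orders \<open>n = q * m\<close> refutes the packing property, since that
  property speaks of all large \<open>n\<close>. The bound \<open>B * m\<^sup>2 / W\<close> on the packing size is \<open>\<theta>\<close> times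
  \<open>n\<^sup>2 / (k * (k - 1))\<close> with \<open>\<theta> < 1\<close>; the difference between \<open>n\<^sup>2\<close> and \<open>n * (n - 1)\<close> vanishes in the
  limit.
\<close>

lemma unavoidable_if_avoiding_packings_sparse:
  fixes G :: "nat \<Rightarrow> nat set set" and q k W B :: nat
  assumes F: "F \<in> colorings {..<k}" and k: "k \<ge> 2" and q: "q > 0"
    and G: "\<And>m. G m \<in> colorings {..<q * m}"
    and sparse: "\<And>m P. avoiding_packing k F {..<q * m} (G m) P \<Longrightarrow> card P * W \<le> B * m\<^sup>2"
    and ratio: "B * (k * (k - 1)) < W * q\<^sup>2"
  shows "unavoidable k (iso_class k F)"
proof -
  have "\<not> asymptotic_packing_property k (coloring_classes k - {iso_class k F})"
  proof
    assume app: "asymptotic_packing_property k (coloring_classes k - {iso_class k F})"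
    define K where "K = real k * (real k - 1)"
    have K: "K > 0" using k by (simp add: K_def)
    have W: "real W > 0" using ratio by (cases W) auto
    define \<theta> where "\<theta> = B * K / (W * (real q)\<^sup>2)"
    have "real (B * (k * (k - 1))) < real (W * q\<^sup>2)" using ratio by linarith
    hence r: "B * K < W * (real q)\<^sup>2"
      using k by (simp add: K_def of_nat_diff)
    hence \<theta>1: "\<theta> < 1" using W q by (simp add: \<theta>_def)
    have \<theta>0: "\<theta> \<ge> 0" using K by (simp add: \<theta>_def)
    \<comment> \<open>Half of the loss serves as \<open>\<epsilon>\<close>; the other half absorbs \<open>n\<^sup>2 - n * (n - 1)\<close>.\<close>
    have "(1 - \<theta>) / 2 > 0" using \<theta>1 by simp
    from app[unfolded asymptotic_packing_property_def, rule_format, OF this]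
    obtain N where N: "\<And>n G. n \<ge> N \<Longrightarrow> G \<in> colorings {..<n} \<Longrightarrow>
      \<exists>P. packing k (coloring_classes k - {iso_class k F}) {..<n} G P \<and>
          real (card P) \<ge> real n * (real n - 1) / (real k * (real k - 1)) * (1 - (1 - \<theta>) / 2)"
      unfolding eventually_sequentially by blast
    obtain M :: nat where M: "(1 + \<theta>) / (1 - \<theta>) < real M" using reals_Archimedean2 by blast
    define m where "m = max (max N M) 1"
    define n where "n = q * m"
    have "q * m \<ge> 1 * m" using q by (intro mult_le_mono1) simp
    hence n: "n \<ge> N" "n \<ge> M" "n \<ge> 1" unfolding n_def m_def by linarith+
    from N[OF n(1) G[of m, folded n_def]] obtain P where
      P: "packing k (coloring_classes k - {iso_class k F}) {..<n} (G m) P"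
      and Pc: "real (card P) \<ge> real n * (real n - 1) / K * (1 - (1 - \<theta>) / 2)"
      unfolding K_def by blast
    have "card P * W \<le> B * m\<^sup>2"
      using sparse packing_imp_avoiding_packing[OF F P] unfolding n_def by blast
    hence "real (card P * W) \<le> real (B * m\<^sup>2)" by (simp only: of_nat_le_iff)
    hence "real (card P) \<le> real B * (real m)\<^sup>2 / W" using W by (simp add: field_simps)
    also have "\<dots> = \<theta> * (real n)\<^sup>2 / K"
      using K W q by (simp add: \<theta>_def n_def field_simps)
    finally have "real n * (real n - 1) / K * (1 - (1 - \<theta>) / 2) \<le> \<theta> * (real n)\<^sup>2 / K"
      using Pc by linarith
    hence "(real n * (real n - 1) * (1 - (1 - \<theta>) / 2)) / K \<le> (\<theta> * (real n)\<^sup>2) / K"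
      by simp
    hence "real n * (real n - 1) * (1 - (1 - \<theta>) / 2) \<le> \<theta> * (real n)\<^sup>2"
      using K by (subst (asm) divide_le_cancel) auto
    moreover have "1 - (1 - \<theta>) / 2 = (1 + \<theta>) / 2" by (simp add: field_simps)
    ultimately have "real n * ((real n - 1) * ((1 + \<theta>) / 2)) \<le> real n * (\<theta> * real n)"
      by (simp only: power2_eq_square mult_ac)
    hence "(real n - 1) * ((1 + \<theta>) / 2) \<le> \<theta> * real n"
      using n(3) by (subst (asm) mult_le_cancel_left_pos) auto
    hence "real n * (1 - \<theta>) \<le> 1 + \<theta>" by (simp add: algebra_simps)
    moreover have "(1 + \<theta>) / (1 - \<theta>) < real n" using M n(2) by linarith
    hence "1 + \<theta> < real n * (1 - \<theta>)" using \<theta>1 by (simp add: pos_divide_less_eq)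
    ultimately show False by linarith
  qed
  moreover have "iso_class k F \<in> coloring_classes k"
    using F unfolding iso_class_def coloring_classes_def by (rule quotientI)
  ultimately show ?thesis by (simp add: unavoidable_def avoidable_def)
qed

text \<open>
  Exchanging the two colors carries copies of \<open>F\<close> to copies of its complement, on the same vertex
  sets.
\<close>

lemma avoiding_packing_compl_graph:
  assumes "avoiding_packing k (compl_graph {..<k} F) V (compl_graph V G) P"
  shows "avoiding_packing k F V G P"
proof -
  have "isomorphic S (induced (compl_graph V G) S) {..<k} (compl_graph {..<k} F)"
    if S: "S \<in> [V]\<^bsup>k\<^esup>" and iso: "isomorphic S (induced G S) {..<k} F" for S
  proof -
    from iso obtain f where f: "bij_betw f S {..<k}"
      and e: "\<And>u v. u \<in> S \<Longrightarrow> v \<in> S \<Longrightarrow> {u, v} \<in> induced G S \<longleftrightarrow> {f u, f v} \<in> F"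
      unfolding isomorphic_def by blast
    have "{u, v} \<in> induced (compl_graph V G) S \<longleftrightarrow> {f u, f v} \<in> compl_graph {..<k} F"
      if uv: "u \<in> S" "v \<in> S" for u v
    proof -
      have "u \<in> V" "v \<in> V" using S uv by (auto simp: nsets_def)
      moreover have "f u < k" "f v < k" using bij_betwE[OF f] uv by auto
      moreover have "f u = f v \<longleftrightarrow> u = v"
        using f uv by (auto simp: bij_betw_def inj_on_def)
      ultimately show ?thesis
        using e[OF uv] uv by (auto simp: induced_def compl_graph_def nsets_def card_insert_if)
    qed
    with f show ?thesis unfolding isomorphic_def by blast
  qed
  with assms show ?thesis unfolding avoiding_packing_def by blast
qed

section \<open>Weights of vertex sets\<close>

text \<open>
  Pairs are ordered, so each edge contributes twice for a symmetric \<open>w\<close>; this turns the weight of a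
  set into a quadratic form in the sizes of its label classes.
\<close>

definition pair_weight :: "('l \<Rightarrow> 'l \<Rightarrow> nat) \<Rightarrow> ('a \<Rightarrow> 'l) \<Rightarrow> 'a set \<Rightarrow> nat" where
  "pair_weight w c S = (\<Sum>(u, v) \<in> S \<times> S - Id. w (c u) (c v))"

text \<open>Weak duality: edge-disjoint sets share no off-diagonal pair.\<close>

lemma sum_pair_weight_le:
  assumes V: "finite V" and sub: "\<And>S. S \<in> P \<Longrightarrow> S \<subseteq> V"
    and disj: "pairwise (\<lambda>S T. disjnt ([S]\<^bsup>2\<^esup>) ([T]\<^bsup>2\<^esup>)) P"
  shows "(\<Sum>S\<in>P. pair_weight w c S) \<le> pair_weight w c V"
proof -
  have fin: "finite P" "\<And>S. S \<in> P \<Longrightarrow> finite S"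
    using V sub by (meson PowI finite_Pow_iff finite_subset subsetI)+
  have dis: "(S \<times> S - Id) \<inter> (T \<times> T - Id) = {}" if "S \<in> P" "T \<in> P" "S \<noteq> T" for S T
  proof -
    have False if "u \<in> S" "v \<in> S" "u \<in> T" "v \<in> T" "u \<noteq> v" for u v
    proof -
      have "{u, v} \<in> [S]\<^bsup>2\<^esup>" "{u, v} \<in> [T]\<^bsup>2\<^esup>" using that by (auto simp: nsets_def)
      with disj \<open>S \<in> P\<close> \<open>T \<in> P\<close> \<open>S \<noteq> T\<close> show False
        by (meson disjnt_iff pairwiseD)
    qed
    thus ?thesis by auto
  qed
  have "(\<Sum>S\<in>P. pair_weight w c S) = (\<Sum>(u, v) \<in> (\<Union>S\<in>P. S \<times> S - Id). w (c u) (c v))"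
    unfolding pair_weight_def by (subst sum.UNION_disjoint) (use fin dis in auto)
  also have "\<dots> \<le> pair_weight w c V"
    unfolding pair_weight_def by (rule sum_mono2) (use V sub in auto)
  finally show ?thesis .
qed

text \<open>
  The second summand on the left is the contribution of the diagonal, which \<open>pair_weight\<close> omits; it
  is moved to the left because subtraction on \<^typ>\<open>nat\<close> truncates.
\<close>

lemma pair_weight_by_counts:
  assumes S: "finite S" and L: "finite L" "c ` S \<subseteq> L"
  shows "pair_weight w c S + (\<Sum>i\<in>L. w i i * card {v \<in> S. c v = i}) =
    (\<Sum>i\<in>L. \<Sum>j\<in>L. w i j * card {v \<in> S. c v = i} * card {v \<in> S. c v = j})"
proof -
  have grp: "(\<Sum>v\<in>S. f (c v)) = (\<Sum>i\<in>L. f i * card {v \<in> S. c v = i})" for f :: "'b \<Rightarrow> nat"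
    using sum_fun_comp[OF S L, of f] by (simp add: mult.commute)
  have "(\<Sum>(u, v) \<in> S \<times> S. w (c u) (c v)) =
      pair_weight w c S + (\<Sum>(u, v) \<in> Id_on S. w (c u) (c v))"
    unfolding pair_weight_def
    by (subst sum.union_disjoint[symmetric]) (use S in \<open>auto intro!: sum.cong simp: Id_on_def\<close>)
  also have "(\<Sum>(u, v) \<in> Id_on S. w (c u) (c v)) = (\<Sum>v\<in>S. w (c v) (c v))"
    by (rule sum.reindex_bij_witness[of _ "\<lambda>v. (v, v)" fst]) auto
  finally have "pair_weight w c S + (\<Sum>i\<in>L. w i i * card {v \<in> S. c v = i})
      = (\<Sum>u\<in>S. \<Sum>v\<in>S. w (c u) (c v))"
    by (simp add: grp[of "\<lambda>i. w i i"] sum.cartesian_product)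
  also have "\<dots> = (\<Sum>i\<in>L. \<Sum>j\<in>L. w i j * card {v \<in> S. c v = i} * card {v \<in> S. c v = j})"
    by (simp add: grp[of "\<lambda>i. \<Sum>j\<in>L. w i j * card {v \<in> S. c v = j}"] grp[of "w _"]
        sum_distrib_left mult_ac)
  finally show ?thesis .
qed

section \<open>Complete multipartite colorings\<close>

definition multipartite :: "'a set \<Rightarrow> ('a \<Rightarrow> 'l) \<Rightarrow> 'a set set" where
  "multipartite V c = {{u, v} | u v. u \<in> V \<and> v \<in> V \<and> c u \<noteq> c v}"

lemma edge_in_multipartite:
  "{u, v} \<in> multipartite V c \<longleftrightarrow> u \<in> V \<and> v \<in> V \<and> c u \<noteq> c v"
  by (auto simp: multipartite_def doubleton_eq_iff)

lemma multipartite_in_colorings: "multipartite V c \<in> colorings V"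
  by (auto simp: multipartite_def colorings_def nsets_def card_insert_if)

lemma induced_multipartite:
  "S \<subseteq> V \<Longrightarrow> induced (multipartite V c) S = multipartite S c"
  by (auto simp: multipartite_def induced_def nsets_def card_insert_if)

text \<open>Bijections between the parts glue to one between the vertex sets.\<close>

lemma isomorphic_multipartite:
  assumes S: "finite S" and T: "finite T"
    and eq: "\<And>i. card {v \<in> S. c v = i} = card {v \<in> T. d v = i}"
  shows "isomorphic S (multipartite S c) T (multipartite T d)"
proof -
  have "\<exists>g. bij_betw g {v \<in> S. c v = i} {v \<in> T. d v = i}" for i
    using S T eq by (intro finite_same_card_bij) auto
  then obtain g where g: "\<And>i. bij_betw (g i) {v \<in> S. c v = i} {v \<in> T. d v = i}"
    by metis
  define f where "f v = g (c v) v" for v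
  have f: "f v \<in> T" "d (f v) = c v" if "v \<in> S" for v
    using bij_betwE[OF g[of "c v"]] that by (auto simp: f_def)
  have "inj_on f S"
  proof (rule inj_onI)
    fix u v assume uv: "u \<in> S" "v \<in> S" "f u = f v"
    hence "c u = c v" using f(2) by metis
    with uv bij_betw_imp_inj_on[OF g[of "c v"]] show "u = v"
      by (auto simp: f_def inj_on_def)
  qed
  moreover have "f ` S = T"
  proof
    show "T \<subseteq> f ` S"
    proof
      fix t assume "t \<in> T"
      hence "t \<in> g (d t) ` {v \<in> S. c v = d t}"
        using bij_betw_imp_surj_on[OF g[of "d t"]] by simp
      then obtain v where "v \<in> S" "c v = d t" "t = g (d t) v" by blast
      thus "t \<in> f ` S" by (intro image_eqI[of _ _ v]) (simp_all add: f_def)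
    qed
  qed (use f in auto)
  ultimately have "bij_betw f S T" by (simp add: bij_betw_def)
  with f show ?thesis unfolding isomorphic_def by (auto simp: edge_in_multipartite)
qed

text \<open>
  The duality criterion. Since \<open>pair_weight\<close> counts ordered pairs, \<open>W / (k * (k - 1))\<close> and
  \<open>B / q\<^sup>2\<close> are both averages over ordered pairs: the first is a lower bound for every \<open>k\<close>-set that
  the packing may use, the second asymptotically an upper bound for the host graph.
\<close>

lemma unavoidable_by_weights:
  fixes c :: "nat \<Rightarrow> 'l" and w :: "'l \<Rightarrow> 'l \<Rightarrow> nat" and q k W B :: nat
  assumes F: "F \<in> colorings {..<k}" and k: "k \<ge> 2" and q: "q > 0"
    and heavy: "\<And>S. finite S \<Longrightarrow> card S = k \<Longrightarrow>
      \<not> isomorphic S (multipartite S c) {..<k} F \<Longrightarrow> W \<le> pair_weight w c S"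
    and total: "\<And>m. pair_weight w c {..<q * m} \<le> B * m\<^sup>2"
    and ratio: "B * (k * (k - 1)) < W * q\<^sup>2"
  shows "unavoidable k (iso_class k F) \<and> unavoidable k (iso_class k (compl_graph {..<k} F))"
proof -
  let ?G = "\<lambda>m. multipartite {..<q * m} c"
  have sparse: "card P * W \<le> B * m\<^sup>2" if P: "avoiding_packing k F {..<q * m} (?G m) P" for m P
  proof -
    have sub: "S \<subseteq> {..<q * m}" "finite S" "card S = k" if "S \<in> P" for S
      using P that by (auto simp: avoiding_packing_def nsets_def)
    have "card P * W \<le> (\<Sum>S\<in>P. pair_weight w c S)"
    proof -
      have "W \<le> pair_weight w c S" if "S \<in> P" for S
        using P that sub[OF that]
        by (intro heavy) (auto simp: avoiding_packing_def induced_multipartite)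
      thus ?thesis using sum_mono[of P "\<lambda>_. W"] by simp
    qed
    also have "\<dots> \<le> pair_weight w c {..<q * m}"
      using P sub by (intro sum_pair_weight_le) (auto simp: avoiding_packing_def)
    finally show ?thesis using total[of m] by linarith
  qed
  have "unavoidable k (iso_class k F)"
    by (rule unavoidable_if_avoiding_packings_sparse[OF F k q multipartite_in_colorings sparse ratio])
  moreover have "unavoidable k (iso_class k (compl_graph {..<k} F))"
  proof (rule unavoidable_if_avoiding_packings_sparse[OF _ k q _ _ ratio])
    show "compl_graph {..<k} F \<in> colorings {..<k}"
      by (auto simp: compl_graph_def colorings_def)
    show "compl_graph {..<q * m} (?G m) \<in> colorings {..<q * m}" for m
      by (auto simp: compl_graph_def colorings_def)
    show "card P * W \<le> B * m\<^sup>2"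
      if "avoiding_packing k (compl_graph {..<k} F) {..<q * m} (compl_graph {..<q * m} (?G m)) P"
      for m P
      using sparse avoiding_packing_compl_graph[OF that] .
  qed
  ultimately show ?thesis ..
qed

section \<open>Parts in fixed proportions\<close>

text \<open>
  Labelling each vertex by its residue modulo \<open>q\<close> realizes parts of sizes in any given integer
  proportion, with exact counts and no dependence of the labelling on the order of the graph.
\<close>

lemma card_residue_label:
  assumes "q > 0"
  shows "card {v \<in> {..<q * m}. l (v mod q) = i} = card {r. r < q \<and> l r = i} * m"
proof -
  have "bij_betw (\<lambda>v. (v mod q, v div q)) {v \<in> {..<q * m}. l (v mod q) = i}
      ({r. r < q \<and> l r = i} \<times> {..<m})"
  proof (rule bij_betw_byWitness[where f' = "\<lambda>(r, t). q * t + r"])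
    have "q * t + r < q * m" if "r < q" "t < m" for r t
    proof -
      have "q * t + r < q * Suc t" using that by simp
      also have "\<dots> \<le> q * m" using that by (intro mult_le_mono2) simp
      finally show ?thesis .
    qed
    thus "(\<lambda>(r, t). q * t + r) ` ({r. r < q \<and> l r = i} \<times> {..<m})
        \<subseteq> {v \<in> {..<q * m}. l (v mod q) = i}"
      by auto
  qed (use assms in \<open>auto simp: less_mult_imp_div_less mult.commute\<close>)
  thus ?thesis by (auto dest: bij_betw_same_card)
qed

lemma pair_weight_residue_label_le:
  assumes "q > 0" "finite L" "range l \<subseteq> L"
  shows "pair_weight w (\<lambda>v. l (v mod q)) {..<q * m} \<le>
    (\<Sum>i\<in>L. \<Sum>j\<in>L. w i j * card {r. r < q \<and> l r = i} * card {r. r < q \<and> l r = j}) * m\<^sup>2"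
proof -
  have "pair_weight w (\<lambda>v. l (v mod q)) {..<q * m} \<le>
      (\<Sum>i\<in>L. \<Sum>j\<in>L. w i j * card {v \<in> {..<q * m}. l (v mod q) = i}
        * card {v \<in> {..<q * m}. l (v mod q) = j})"
    using pair_weight_by_counts[of "{..<q * m}" L "\<lambda>v. l (v mod q)" w] assms by fastforce
  also have "\<dots> = (\<Sum>i\<in>L. \<Sum>j\<in>L. w i j * card {r. r < q \<and> l r = i}
      * card {r. r < q \<and> l r = j}) * m\<^sup>2"
    unfolding card_residue_label[OF assms(1)]
    by (simp add: sum_distrib_left power2_eq_square mult_ac)
  finally show ?thesis .
qed

section \<open>Complete graphs\<close>

lemma colorings_eqI:
  assumes "G \<in> colorings V" "H \<in> colorings V"
    and "\<And>u v. u \<in> V \<Longrightarrow> v \<in> V \<Longrightarrow> {u, v} \<in> G \<longleftrightarrow> {u, v} \<in> H"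
  shows "G = H"
proof -
  have "e \<in> G \<longleftrightarrow> e \<in> H" if e: "e \<in> [V]\<^bsup>2\<^esup>" for e
  proof -
    from e obtain u v where "e = {u, v}" "u \<in> V" "v \<in> V"
      by (auto simp: nsets_def card_2_iff)
    with assms(3) show ?thesis by blast
  qed
  with assms(1,2) show ?thesis unfolding colorings_def by blast
qed

lemma complete_graph_eq_multipartite: "complete_graph k = multipartite {..<k} id"
  by (auto simp: complete_graph_def multipartite_def nsets_def card_2_iff card_insert_if)

lemma unavoidable_complete_graph:
  assumes "k \<ge> 2"
  shows "unavoidable k (iso_class k (complete_graph k)) \<and>
    unavoidable k (iso_class k (compl_graph {..<k} (complete_graph k)))"
proof (rule unavoidable_by_weights[where c = id and w = "\<lambda>_ _. 0" and W = 1 and B = 0 and q = 1])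
  show "complete_graph k \<in> colorings {..<k}"
    by (simp add: complete_graph_eq_multipartite multipartite_in_colorings)
  show "1 \<le> pair_weight (\<lambda>_ _. 0) id S"
    if "finite S" "card S = k"
      and not_iso: "\<not> isomorphic S (multipartite S id) {..<k} (complete_graph k)" for S :: "nat set"
  proof -
    obtain f where f: "bij_betw f S {..<k}"
      using finite_same_card_bij[of S "{..<k}"] \<open>finite S\<close> \<open>card S = k\<close> by auto
    hence "isomorphic S (multipartite S id) {..<k} (complete_graph k)"
      unfolding isomorphic_def
      by (intro exI[of _ f])
        (auto simp: complete_graph_eq_multipartite edge_in_multipartite bij_betw_def inj_on_def)
    with not_iso show ?thesis ..
  qed
qed (use assms in \<open>auto simp: pair_weight_def\<close>)

section \<open>Complete bipartite graphs\<close>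

lemma complete_bipartite_in_colorings: "complete_bipartite a b \<in> colorings {..<a + b}"
  by (auto simp: complete_bipartite_def colorings_def nsets_def card_insert_if)

lemma edge_in_complete_bipartite:
  "{u, v} \<in> complete_bipartite a b \<longleftrightarrow>
    u < a \<and> a \<le> v \<and> v < a + b \<or> v < a \<and> a \<le> u \<and> u < a + b"
  unfolding complete_bipartite_def mem_Collect_eq doubleton_eq_iff lessThan_iff atLeastLessThan_iff
  by blast

lemma complete_bipartite_eq_multipartite:
  assumes "i \<noteq> j"
  shows "complete_bipartite a b = multipartite {..<a + b} (\<lambda>v. if v < a then i else j)"
proof (rule colorings_eqI[of _ "{..<a + b}"])
  fix u v assume "u \<in> {..<a + b}" "v \<in> {..<a + b}"
  thus "{u, v} \<in> complete_bipartite a b \<longleftrightarrow>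
      {u, v} \<in> multipartite {..<a + b} (\<lambda>v. if v < a then i else j)"
    using assms by (auto simp: edge_in_complete_bipartite edge_in_multipartite)
qed (rule complete_bipartite_in_colorings multipartite_in_colorings)+

lemma isomorphic_complete_bipartite:
  assumes S: "finite S" and L: "c ` S \<subseteq> {i, j}" "i \<noteq> j"
    and card: "card {v \<in> S. c v = i} = a" "card {v \<in> S. c v = j} = b" and k: "k = a + b"
  shows "isomorphic S (multipartite S c) {..<k} (complete_bipartite a b)"
  unfolding complete_bipartite_eq_multipartite[OF L(2)] k
proof (rule isomorphic_multipartite)
  fix x
  let ?d = "\<lambda>v. if v < a then i else j"
  have fib: "{v \<in> {..<a + b}. ?d v = i} = {..<a}" "{v \<in> {..<a + b}. ?d v = j} = {a..<a + b}"
    using L(2) by auto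
  show "card {v \<in> S. c v = x} = card {v \<in> {..<a + b}. ?d v = x}"
  proof (cases "x \<in> {i, j}")
    case True
    then consider "x = i" | "x = j" by blast
    thus ?thesis by cases (simp_all only: fib card card_lessThan card_atLeastLessThan add_diff_cancel_left')
  next
    case False
    hence "{v \<in> S. c v = x} = {}" "{v \<in> {..<a + b}. ?d v = x} = {}" using L(1) by auto
    thus ?thesis by (simp only: card.empty)
  qed
qed (use S in auto)

lemma card_two_labels:
  assumes S: "finite S" "c ` S \<subseteq> {0, 1 :: nat}"
  shows "card {v \<in> S. c v = 0} + card {v \<in> S. c v = 1} = card S"
  using sum_fun_comp[OF S(1) _ S(2), of "\<lambda>_. 1 :: nat"] by simp

text \<open>
  With \<open>a\<close> vertices in the small part, the weight of a \<open>k\<close>-set exceeds \<open>k * (k - 1)\<close> by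
  \<open>2 * (k - 1) * a * (a - 2)\<close>: the weight \<open>2 * k - 3\<close> inside the small part is the least for which
  \<open>a = 2\<close> is allowed.
\<close>

lemma unavoidable_star:
  assumes "k \<ge> 2"
  shows "unavoidable k (iso_class k (complete_bipartite 1 (k - 1))) \<and>
    unavoidable k (iso_class k (compl_graph {..<k} (complete_bipartite 1 (k - 1))))"
proof -
  define l :: "nat \<Rightarrow> nat" where "l r = (if r = 0 then 0 else 1)" for r
  define c where "c v = l (v mod k)" for v
  define w :: "nat \<Rightarrow> nat \<Rightarrow> nat" where
    "w i j = (if i \<noteq> j then 0 else if i = 0 then 2 * k - 3 else 1)" for i j
  have l: "range l \<subseteq> {0, 1}" by (auto simp: l_def)
  have k: "Suc (k - 1) = k" using assms by simp
  have fib: "{r. r < k \<and> l r = 0} = {0}" "{r. r < k \<and> l r = Suc 0} = {1..<k}"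
    using assms by (auto simp: l_def)
  show ?thesis
  proof (rule unavoidable_by_weights[where c = c and w = w and q = k and W = "k * (k - 1)"
        and B = "2 * k - 3 + (k - 1)\<^sup>2"])
    show "complete_bipartite 1 (k - 1) \<in> colorings {..<k}"
      using complete_bipartite_in_colorings[of 1 "k - 1"] k by simp
  next
    fix S :: "nat set"
    assume S: "finite S" "card S = k"
      and not_iso: "\<not> isomorphic S (multipartite S c) {..<k} (complete_bipartite 1 (k - 1))"
    have cS: "c ` S \<subseteq> {0, 1}" by (auto simp: c_def l_def)
    define a b where "a = card {v \<in> S. c v = 0}" and "b = card {v \<in> S. c v = 1}"
    have ab: "a + b = k" using card_two_labels[OF S(1) cS] S(2) by (simp add: a_def b_def)
    have "a \<noteq> 1"
    proof
      assume "a = 1"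
      with ab have "card {v \<in> S. c v = 0} = 1" "card {v \<in> S. c v = 1} = k - 1"
        unfolding a_def b_def by linarith+
      hence "isomorphic S (multipartite S c) {..<k} (complete_bipartite 1 (k - 1))"
        by (intro isomorphic_complete_bipartite[OF S(1) cS]) (use assms in auto)
      with not_iso show False ..
    qed
    have "pair_weight w c S + ((2 * k - 3) * a + b) = (2 * k - 3) * a * a + b * b"
      using pair_weight_by_counts[OF S(1) _ cS, of w] by (simp add: w_def a_def b_def)
    hence "int (pair_weight w c S + ((2 * k - 3) * a + b)) = int ((2 * k - 3) * a * a + b * b)"
      by (rule arg_cong)
    moreover have "int (2 * k - 3) = 2 * int k - 3" using assms by simp
    ultimately have "int (pair_weight w c S) + ((2 * int k - 3) * int a + int b)
        = (2 * int k - 3) * int a * int a + int b * int b"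
      by (simp only: of_nat_add of_nat_mult)
    hence pw: "int (pair_weight w c S)
        = (2 * int k - 3) * (int a * int a - int a) + (int b * int b - int b)"
      by (simp add: algebra_simps)
    have b: "int b = int k - int a" using ab by linarith
    have "int (pair_weight w c S) - int k * (int k - 1) = 2 * (int k - 1) * (int a * (int a - 2))"
      unfolding pw b by (simp add: algebra_simps)
    moreover
    \<comment> \<open>The product is negative only at \<open>a = 1\<close>, the excluded star.\<close>
    have "0 \<le> int a * (int a - 2)" using \<open>a \<noteq> 1\<close> by (cases "a = 0") auto
    have "0 \<le> 2 * (int k - 1)" using assms by simp
    from this \<open>0 \<le> int a * (int a - 2)\<close> have "0 \<le> 2 * (int k - 1) * (int a * (int a - 2))"
      by (rule mult_nonneg_nonneg)
    ultimately have "int k * (int k - 1) \<le> int (pair_weight w c S)" by linarith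
    also have "int k * (int k - 1) = int (k * (k - 1))" using assms by (simp add: of_nat_diff)
    finally show "k * (k - 1) \<le> pair_weight w c S" by (simp only: of_nat_le_iff)
  next
    show "pair_weight w c {..<k * m} \<le> (2 * k - 3 + (k - 1)\<^sup>2) * m\<^sup>2" for m
      using pair_weight_residue_label_le[OF _ _ l, of k w m] assms
      by (simp add: fib w_def power2_eq_square flip: c_def)
  next
    have "2 * k - 3 + (k - 1)\<^sup>2 < k\<^sup>2"
    proof -
      obtain t where "k = t + 2" using assms by (metis add.commute le_Suc_ex)
      thus ?thesis by (simp add: power2_eq_square)
    qed
    thus "(2 * k - 3 + (k - 1)\<^sup>2) * (k * (k - 1)) < k * (k - 1) * k\<^sup>2"
      using assms by (simp add: mult.commute)
  qed (use assms in auto)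
qed

text \<open>
  In a host with two equal parts the edges inside the parts make up half of all edges. So it is
  enough that, apart from the split of \<open>K\<^bsub>a,b\<^esub>\<close>, every split of \<open>a + b\<close> vertices has more than half
  of its pairs inside the parts. Here \<open>W\<close> bounds the number of ordered pairs inside the parts,
  \<open>x * (x - 1) + y * (y - 1)\<close>, from below.
\<close>

lemma unavoidable_complete_bipartite:
  fixes a b W :: nat
  assumes k: "a + b \<ge> 2"
    and heavy: "\<And>x y. x + y = a + b \<Longrightarrow> (x, y) \<noteq> (a, b) \<Longrightarrow> (x, y) \<noteq> (b, a) \<Longrightarrow>
      W + (x + y) \<le> x * x + y * y"
    and ratio: "(a + b) * (a + b - 1) < 2 * W"
  shows "unavoidable (a + b) (iso_class (a + b) (complete_bipartite a b)) \<and>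
    unavoidable (a + b) (iso_class (a + b) (compl_graph {..<a + b} (complete_bipartite a b)))"
proof -
  define l :: "nat \<Rightarrow> nat" where "l r = (if r = 0 then 0 else 1)" for r
  define c where "c v = l (v mod 2)" for v
  define w :: "nat \<Rightarrow> nat \<Rightarrow> nat" where "w i j = (if i = j then 1 else 0)" for i j
  have l: "range l \<subseteq> {0, 1}" by (auto simp: l_def)
  have fib: "{r. r < 2 \<and> l r = 0} = {0}" "{r. r < 2 \<and> l r = Suc 0} = {1}"
    by (auto simp: l_def)
  show ?thesis
  proof (rule unavoidable_by_weights[where c = c and w = w and q = 2 and W = W and B = 2])
    show "complete_bipartite a b \<in> colorings {..<a + b}"
      by (rule complete_bipartite_in_colorings)
  next
    fix S :: "nat set"
    assume S: "finite S" "card S = a + b"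
      and not_iso: "\<not> isomorphic S (multipartite S c) {..<a + b} (complete_bipartite a b)"
    have cS: "c ` S \<subseteq> {0, 1}" by (auto simp: c_def l_def)
    hence cS': "c ` S \<subseteq> {1, 0}" by auto
    define x y where "x = card {v \<in> S. c v = 0}" and "y = card {v \<in> S. c v = 1}"
    have xy: "x + y = a + b" using card_two_labels[OF S(1) cS] S(2) by (simp add: x_def y_def)
    have "(x, y) \<noteq> (a, b)" "(x, y) \<noteq> (b, a)"
      using not_iso isomorphic_complete_bipartite[OF S(1) cS, of a b "a + b"]
        isomorphic_complete_bipartite[OF S(1) cS', of a b "a + b"]
      unfolding x_def y_def by auto
    hence "W + (x + y) \<le> x * x + y * y" using heavy xy by blast
    moreover have "pair_weight w c S + (x + y) = x * x + y * y"
      using pair_weight_by_counts[OF S(1) _ cS, of w] by (simp add: w_def x_def y_def)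
    ultimately show "W \<le> pair_weight w c S" by linarith
  next
    show "pair_weight w c {..<2 * m} \<le> 2 * m\<^sup>2" for m
      using pair_weight_residue_label_le[OF _ _ l, of 2 w m]
      by (simp add: fib w_def flip: c_def)
  qed (use k ratio in auto)
qed

section \<open>The graph \<open>K\<^sub>4\<^sup>-\<close>\<close>

lemma K4_minus_in_colorings: "K4_minus \<in> colorings {..<4}"
  by (auto simp: K4_minus_def complete_graph_def colorings_def)

text \<open>
  \<open>K\<^sub>4\<^sup>-\<close> is the complete tripartite graph with parts of sizes \<open>2\<close>, \<open>1\<close> and \<open>1\<close>. The labels are
  arbitrary because any of the three parts of the host may be the one that is met twice.
\<close>

lemma K4_minus_eq_multipartite:
  assumes "i \<noteq> j" "i \<noteq> h" "j \<noteq> h"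
  shows "K4_minus = multipartite {..<4} (\<lambda>v. if v < 2 then i else if v = 2 then j else h)"
proof (rule colorings_eqI[of _ "{..<4}"])
  let ?d = "\<lambda>v::nat. if v < 2 then i else if v = 2 then j else h"
  fix u v :: nat assume uv: "u \<in> {..<4}" "v \<in> {..<4}"
  have "{u, v} \<in> K4_minus \<longleftrightarrow> u \<noteq> v \<and> {u, v} \<noteq> {0, 1}"
    using uv by (simp add: K4_minus_def complete_graph_eq_multipartite edge_in_multipartite)
  also have "\<dots> \<longleftrightarrow> u \<noteq> v \<and> \<not> (u < 2 \<and> v < 2)"
    by (auto simp: doubleton_eq_iff)
  also have "\<dots> \<longleftrightarrow> ?d u \<noteq> ?d v" using assms uv by auto
  finally show "{u, v} \<in> K4_minus \<longleftrightarrow> {u, v} \<in> multipartite {..<4} ?d"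
    using uv by (simp add: edge_in_multipartite)
qed (rule K4_minus_in_colorings multipartite_in_colorings)+

lemma isomorphic_K4_minus:
  assumes S: "finite S" and L: "c ` S \<subseteq> {i, j, h}" "i \<noteq> j" "i \<noteq> h" "j \<noteq> h"
    and card: "card {v \<in> S. c v = i} = 2" "card {v \<in> S. c v = j} = 1" "card {v \<in> S. c v = h} = 1"
  shows "isomorphic S (multipartite S c) {..<4} K4_minus"
  unfolding K4_minus_eq_multipartite[OF L(2-4)]
proof (rule isomorphic_multipartite)
  fix x
  let ?d = "\<lambda>v::nat. if v < 2 then i else if v = 2 then j else h"
  have fib: "{v \<in> {..<4}. ?d v = i} = {0, 1}" "{v \<in> {..<4}. ?d v = j} = {2}"
    "{v \<in> {..<4}. ?d v = h} = {3}"
    using L(2-4) by auto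
  show "card {v \<in> S. c v = x} = card {v \<in> {..<4}. ?d v = x}"
  proof (cases "x \<in> {i, j, h}")
    case True
    then consider "x = i" | "x = j" | "x = h" by blast
    thus ?thesis by cases (simp_all only: fib card, simp_all)
  next
    case False
    hence "{v \<in> S. c v = x} = {}" "{v \<in> {..<4}. ?d v = x} = {}" using L(1) by auto
    thus ?thesis by (simp only: card.empty)
  qed
qed (use S in auto)

text \<open>
  The weights arise from the constant weight \<open>2\<close> by adding \<open>2\<close> inside \<open>A\<close> and \<open>B\<close>, which lets the
  weight between \<open>A\<close> and \<open>B\<close> drop by \<open>1\<close>, and \<open>6\<close> inside \<open>C\<close>, which lets the weight between \<open>C\<close> and
  the rest drop by \<open>2\<close>. The splits \<open>AABB\<close>, \<open>AAAC\<close> and \<open>AACC\<close> keep the weight \<open>12\<close>, no permitted split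
  goes below it, and the average over the host falls from \<open>2\<close> to \<open>48 / 25\<close>.
\<close>

lemma unavoidable_K4_minus:
  "unavoidable 4 (iso_class 4 K4_minus) \<and>
    unavoidable 4 (iso_class 4 (compl_graph {..<4} K4_minus))"
proof -
  define l :: "nat \<Rightarrow> nat" where "l r = (if r < 2 then 0 else if r < 4 then 1 else 2)" for r
  define c where "c v = l (v mod 5)" for v
  define w :: "nat \<Rightarrow> nat \<Rightarrow> nat" where
    "w i j = (if i = 2 \<and> j = 2 then 8 else if i = 2 \<or> j = 2 then 0 else if i = j then 4 else 1)"
    for i j
  have l: "range l \<subseteq> {0, 1, 2}" by (auto simp: l_def)
  have fib: "{r. r < 5 \<and> l r = 0} = {0, 1}" "{r. r < 5 \<and> l r = Suc 0} = {2, 3}"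
    "{r. r < 5 \<and> l r = 2} = {4}"
    by (auto simp: l_def)
  show ?thesis
  proof (rule unavoidable_by_weights[where c = c and w = w and q = 5 and W = 24 and B = 48])
    show "K4_minus \<in> colorings {..<4}" by (rule K4_minus_in_colorings)
  next
    fix S :: "nat set"
    assume S: "finite S" "card S = 4"
      and not_iso: "\<not> isomorphic S (multipartite S c) {..<4} K4_minus"
    have cS: "c ` S \<subseteq> {0, 1, 2}" by (auto simp: c_def l_def)
    hence cS': "c ` S \<subseteq> {1, 0, 2}" "c ` S \<subseteq> {2, 0, 1}" by auto
    define x y z where "x = card {v \<in> S. c v = 0}" and "y = card {v \<in> S. c v = 1}"
      and "z = card {v \<in> S. c v = 2}"
    have xyz: "x + y + z = 4"
      using sum_fun_comp[OF S(1) _ cS, of "\<lambda>_. 1 :: nat"] S(2) by (simp add: x_def y_def z_def)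
    have "(x, y, z) \<noteq> (2, 1, 1)" "(x, y, z) \<noteq> (1, 2, 1)" "(x, y, z) \<noteq> (1, 1, 2)"
      using not_iso isomorphic_K4_minus[OF S(1) cS] isomorphic_K4_minus[OF S(1) cS'(1)]
        isomorphic_K4_minus[OF S(1) cS'(2)]
      unfolding x_def y_def z_def by auto
    moreover have "pair_weight w c S + (4 * x + 4 * y + 8 * z)
        = 4 * (x * x) + 4 * (y * y) + 8 * (z * z) + 2 * (x * y)"
      using pair_weight_by_counts[OF S(1) _ cS, of w] by (simp add: w_def x_def y_def z_def)
    moreover have "x \<in> {0, 1, 2, 3, 4}" "y \<in> {0, 1, 2, 3, 4}" using xyz by auto
    moreover have "z = 4 - x - y" using xyz by simp
    ultimately show "24 \<le> pair_weight w c S" using xyz by auto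
  next
    show "pair_weight w c {..<5 * m} \<le> 48 * m\<^sup>2" for m
      using pair_weight_residue_label_le[OF _ _ l, of 5 w m]
      by (simp add: fib w_def flip: c_def)
  qed auto
qed

theorem proposition1p1:
  shows "(\<forall>k::nat. k \<ge> 2 \<longrightarrow>
            unavoidable k (iso_class k (complete_graph k)) \<and>
            unavoidable k (iso_class k (compl_graph {..<k} (complete_graph k))) \<and>
            unavoidable k (iso_class k (complete_bipartite 1 (k - 1))) \<and>
            unavoidable k (iso_class k (compl_graph {..<k} (complete_bipartite 1 (k - 1))))) \<and>
         unavoidable 5 (iso_class 5 (complete_bipartite 2 3)) \<and>
         unavoidable 5 (iso_class 5 (compl_graph {..<5} (complete_bipartite 2 3))) \<and>
         unavoidable 7 (iso_class 7 (complete_bipartite 3 4)) \<and>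
         unavoidable 7 (iso_class 7 (compl_graph {..<7} (complete_bipartite 3 4))) \<and>
         unavoidable 4 (iso_class 4 K4_minus) \<and>
         unavoidable 4 (iso_class 4 (compl_graph {..<4} K4_minus))"
proof -
  \<comment> \<open>The splits \<open>1 + 4\<close> of five and \<open>2 + 5\<close> of seven vertices are extremal, with \<open>12\<close> of \<open>20\<close>
    and \<open>22\<close> of \<open>42\<close> ordered pairs inside the parts.\<close>
  have "12 + (x + y) \<le> x * x + y * y"
    if "x + y = 2 + 3" "(x, y) \<noteq> (2, 3)" "(x, y) \<noteq> (3, 2)" for x y :: nat
  proof -
    have "x \<in> {0, 1, 2, 3, 4, 5}" "y = 5 - x" using that by auto
    thus ?thesis using that by auto
  qed
  from unavoidable_complete_bipartite[of 2 3 12, OF _ this]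
  have "unavoidable 5 (iso_class 5 (complete_bipartite 2 3)) \<and>
    unavoidable 5 (iso_class 5 (compl_graph {..<5} (complete_bipartite 2 3)))"
    by simp
  moreover have "22 + (x + y) \<le> x * x + y * y"
    if "x + y = 3 + 4" "(x, y) \<noteq> (3, 4)" "(x, y) \<noteq> (4, 3)" for x y :: nat
  proof -
    have "x \<in> {0, 1, 2, 3, 4, 5, 6, 7}" "y = 7 - x" using that by auto
    thus ?thesis using that by auto
  qed
  from unavoidable_complete_bipartite[of 3 4 22, OF _ this]
  have "unavoidable 7 (iso_class 7 (complete_bipartite 3 4)) \<and>
    unavoidable 7 (iso_class 7 (compl_graph {..<7} (complete_bipartite 3 4)))"
    by simp
  ultimately show ?thesis
    using unavoidable_complete_graph unavoidable_star unavoidable_K4_minus by blast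
qed

end
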